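(* Let $X$ be a Banach space and $C\subset X$ a closed, bounded and convex set. Let $\mathcal{K}(C)$ be the space of non-empty compact subsets of $C$ equipped with the Pompeiu-Hausdorff distance $H$. Fix an arbitrary point $x\in C$. Then there is a set $\mathcal{B}\subset\mathcal{K}(C)$ such that $\mathcal{K}(C)\setminus\mathcal{B}$ is $\sigma$-porous in $(\mathcal{K}(C),H)$ and for every $M\in\mathcal{B}$ the metric projection $P_M(x)$ is a singleton.
   Context: For non-empty compact sets $A,B\subset C$, $H(A,B)=\max\{\sup_{a\in A}\inf_{b\in B}\|a-b\|,\ \sup_{b\in B}\inf_{a\in A}\|a-b\|\}$. For $M\subset X$ and $x\in X$, $\mathrm{dist}(x,M)=\inf_{y\in M}\|x-y\|$ and $P_M(x)=\{y\in M : \|x-y\|=\mathrm{dist}(x,M)\}$. A subset $E$ of a metric space $Y$ is porous at a point $x\in E$ if there exist $r_0>0$ and $\alpha>0$ such that for all $r\in(0,r_0)$ there is a point $y\in B(x,r)$ with $B(y,\alpha r)\cap E=\emptyset$ (here $B$ denotes open balls in $Y$). $E$ is porous if it is porous at all of its points, and $\sigma$-porous if it is a countable union of porous sets. *)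

theory Defs
  imports "HOL-Analysis.Analysis"
begin

section \<open>The Pompeiu-Hausdorff distance and the hyperspace of compact sets\<close>

text \<open>
  The values are meaningful for non-empty compact arguments only; for other sets the suprema
  over the reals may be unspecified.
\<close>

definition hausdorff_distance :: "'a::metric_space set \<Rightarrow> 'a set \<Rightarrow> real" where
  "hausdorff_distance A B = max (SUP a\<in>A. infdist a B) (SUP b\<in>B. infdist b A)"

definition compact_subsets :: "'a::topological_space set \<Rightarrow> 'a set set" where
  "compact_subsets C = {A. A \<subseteq> C \<and> compact A \<and> A \<noteq> {}}"

text \<open>
  The library's metric spaces with carrier need a distance function that is symmetric and
  non-negative also outside the carrier, hence the value 0 there; see \<open>mspace_hyperspace\<close> and
  \<open>mdist_hyperspace\<close> below.
\<close>

definition hyperspace :: "'a::metric_space set \<Rightarrow> 'a set metric" where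
  "hyperspace C = metric (compact_subsets C,
     \<lambda>A B. if A \<in> compact_subsets C \<and> B \<in> compact_subsets C then hausdorff_distance A B else 0)"

lemma bdd_above_infdist:
  fixes A B :: "'a::metric_space set"
  assumes "compact A"
  shows "bdd_above ((\<lambda>a. infdist a B) ` A)"
  by (intro bounded_imp_bdd_above compact_imp_bounded compact_continuous_image
      continuous_on_infdist continuous_on_id assms)

lemma infdist_le_hausdorff_distance:
  assumes "compact A" "a \<in> A"
  shows "infdist a B \<le> hausdorff_distance A B"
  unfolding hausdorff_distance_def
  using cSUP_upper[OF assms(2) bdd_above_infdist[OF assms(1)], of B] by linarith

lemma hausdorff_distance_commute: "hausdorff_distance A B = hausdorff_distance B A"
  unfolding hausdorff_distance_def by (rule max.commute)

lemma hausdorff_distance_leI: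
  assumes "A \<noteq> {}" "B \<noteq> {}" "\<And>a. a \<in> A \<Longrightarrow> infdist a B \<le> e" "\<And>b. b \<in> B \<Longrightarrow> infdist b A \<le> e"
  shows "hausdorff_distance A B \<le> e"
  unfolding hausdorff_distance_def by (intro max.boundedI cSUP_least assms)

lemma hausdorff_distance_nonneg:
  assumes "compact A" "A \<noteq> {}"
  shows "0 \<le> hausdorff_distance A B"
  using assms infdist_le_hausdorff_distance infdist_nonneg by (metis all_not_in_conv order_trans)

lemma hausdorff_distance_eq_0D:
  assumes "compact A" "compact B" "B \<noteq> {}" "hausdorff_distance A B = 0"
  shows "A \<subseteq> B"
proof
  fix a assume "a \<in> A"
  then have "infdist a B = 0"
    using infdist_le_hausdorff_distance[OF assms(1), of a B] infdist_nonneg[of a B] assms(4) by simp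
  then show "a \<in> B"
    using assms(2,3) in_closed_iff_infdist_zero compact_imp_closed by blast
qed

lemma infdist_le_hausdorff_distance_add:
  assumes "compact A" "compact B" "B \<noteq> {}" "a \<in> A"
  shows "infdist a D \<le> hausdorff_distance A B + hausdorff_distance B D"
proof -
  have "infdist a D - hausdorff_distance B D \<le> dist a b" if "b \<in> B" for b
    using infdist_triangle[of a D b] infdist_le_hausdorff_distance[OF assms(2) that, of D] by linarith
  then have "infdist a D - hausdorff_distance B D \<le> infdist a B"
    using assms(3) by (simp add: infdist_notempty cINF_greatest)
  also have "\<dots> \<le> hausdorff_distance A B"
    by (rule infdist_le_hausdorff_distance[OF assms(1,4)])
  finally show ?thesis by simp
qed

lemma hausdorff_distance_triangle:
  assumes "compact A" "A \<noteq> {}" "compact B" "B \<noteq> {}" "compact D" "D \<noteq> {}"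
  shows "hausdorff_distance A D \<le> hausdorff_distance A B + hausdorff_distance B D"
proof (rule hausdorff_distance_leI)
  fix d assume "d \<in> D"
  then show "infdist d A \<le> hausdorff_distance A B + hausdorff_distance B D"
    using infdist_le_hausdorff_distance_add[of D B d A] assms
    by (simp add: hausdorff_distance_commute add.commute)
qed (use assms infdist_le_hausdorff_distance_add in auto)

lemma Metric_space_hyperspace:
  fixes C :: "'a::metric_space set"
  shows "Metric_space (compact_subsets C)
    (\<lambda>A B. if A \<in> compact_subsets C \<and> B \<in> compact_subsets C then hausdorff_distance A B else 0)"
proof
  fix A B :: "'a set"
  assume AB: "A \<in> compact_subsets C" "B \<in> compact_subsets C"
  have "hausdorff_distance A A = 0" 
    using AB by (simp add: hausdorff_distance_def compact_subsets_def)
  moreover have "A = B" if "hausdorff_distance A B = 0"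
    using that AB hausdorff_distance_eq_0D[of A B] hausdorff_distance_eq_0D[of B A]
    by (auto simp: compact_subsets_def hausdorff_distance_commute)
  ultimately show "((if A \<in> compact_subsets C \<and> B \<in> compact_subsets C
      then hausdorff_distance A B else 0) = 0) = (A = B)"
    using AB by auto
qed (auto simp: compact_subsets_def hausdorff_distance_nonneg hausdorff_distance_triangle
    hausdorff_distance_commute)

lemma mspace_hyperspace [simp]: "mspace (hyperspace C) = compact_subsets C"
  unfolding hyperspace_def by (simp add: Metric_space.mspace_metric[OF Metric_space_hyperspace])

lemma mdist_hyperspace:
  assumes "A \<in> compact_subsets C" "B \<in> compact_subsets C"
  shows "mdist (hyperspace C) A B = hausdorff_distance A B"
  unfolding hyperspace_def using assms
  by (simp add: Metric_space.mdist_metric[OF Metric_space_hyperspace])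

section \<open>Porosity\<close>

definition porous_at :: "'a metric \<Rightarrow> 'a set \<Rightarrow> 'a \<Rightarrow> bool" where
  "porous_at Y E x \<longleftrightarrow>
     (\<exists>r0>0. \<exists>\<alpha>>0. \<forall>r. 0 < r \<and> r < r0 \<longrightarrow>
        (\<exists>y \<in> mball_of Y x r. mball_of Y y (\<alpha> * r) \<inter> E = {}))"

definition porous :: "'a metric \<Rightarrow> 'a set \<Rightarrow> bool" where
  "porous Y E \<longleftrightarrow> E \<subseteq> mspace Y \<and> (\<forall>x\<in>E. porous_at Y E x)"

definition sigma_porous :: "'a metric \<Rightarrow> 'a set \<Rightarrow> bool" where
  "sigma_porous Y E \<longleftrightarrow> (\<exists>\<F>. countable \<F> \<and> (\<forall>S\<in>\<F>. porous Y S) \<and> E = \<Union>\<F>)"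

section \<open>The metric projection\<close>

definition metric_projection :: "'a::metric_space set \<Rightarrow> 'a \<Rightarrow> 'a set" where
  "metric_projection M x = {y \<in> M. dist x y = infdist x M}"

end

(* If M has at least two points nearest to x, then x is not in M, so one of them, p, can be moved
   towards x by a small s > 0.  Adding the moved point q to M changes M by at most s, and every N
   within s/4 of insert q M has all its points nearest to x within s/4 of q: points of N close to M
   are too far from x.  Hence the sets M whose projection contains two points more than 1/(n+1)
   apart form a porous set. *)
theory Submission
  imports Defs
begin

lemma hausdorff_distance_less_obtains:
  assumes "compact A" "B \<noteq> {}" "a \<in> A" "hausdorff_distance A B < e"
  obtains b where "b \<in> B" "dist a b < e"
proof -
  have "infdist a B < e"
    using infdist_le_hausdorff_distance[OF assms(1,3), of B] assms(4) by linarith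
  then show thesis
    using that assms(2) by (auto simp: infdist_notempty cINF_less_iff)
qed

text \<open>Only the new point \<open>b\<close> can lie off \<open>A\<close>, and \<open>a\<close>
  bounds its distance to \<open>A\<close>.\<close>

lemma hausdorff_distance_insert_le:
  assumes "a \<in> A"
  shows "hausdorff_distance A (insert b A) \<le> dist a b"
proof (rule hausdorff_distance_leI)
  fix c assume "c \<in> insert b A"
  then show "infdist c A \<le> dist a b"
    using infdist_le[OF assms, of b] by (auto simp: dist_commute)
qed (use assms in auto)

text \<open>By compactness the distance to \<open>x\<close> attains its minimum on \<open>M\<close>,
  so a projection can fail to be a singleton only by containing two points.\<close>

lemma metric_projection_nonempty:
  assumes "compact M" "M \<noteq> {}"
  shows "metric_projection M x \<noteq> {}"
proof -
  obtain y where y: "y \<in> M" "\<And>z. z \<in> M \<Longrightarrow> dist x y \<le> dist x z"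
    using continuous_attains_inf[OF assms continuous_on_dist[OF continuous_on_const continuous_on_id]]
    by blast
  then have "dist x y = infdist x M"
    using assms(2) by (intro antisym infdist_le) (auto simp: infdist_notempty intro: cINF_greatest)
  with y(1) show ?thesis
    by (auto simp: metric_projection_def)
qed

text \<open>The gap \<open>2 * e\<close> pays for two uses of the Hausdorff bound: \<open>N\<close>
  has a point within \<open>e\<close> of \<open>q\<close>, and \<open>u\<close> is within
  \<open>e\<close> of some point of \<open>insert q M\<close>. The gap rules out every point of
  \<open>M\<close>, leaving only \<open>q\<close>.\<close>

lemma metric_projection_near_inserted_point:
  assumes N: "compact N" "N \<noteq> {}" and M: "compact M"
    and "hausdorff_distance N (insert q M) < e"
    and "dist x q + 2 * e \<le> infdist x M"
    and u: "u \<in> metric_projection N x"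
  shows "dist u q < e"
proof -
  obtain v where v: "v \<in> N" "dist q v < e"
    using hausdorff_distance_less_obtains[of "insert q M" N q e] assms
    by (auto simp: hausdorff_distance_commute)
  have uN: "u \<in> N" "dist x u \<le> dist x v"
    using u v(1) by (auto simp: metric_projection_def infdist_le)
  obtain w where w: "w \<in> insert q M" "dist u w < e"
    using hausdorff_distance_less_obtains[of N "insert q M" u e] assms uN by blast
  have "w \<notin> M"
  proof
    assume "w \<in> M"
    \<comment> \<open>Continuing the chain through \<open>v\<close> gives
      \<open>infdist x M < dist x q + 2 * e\<close>, against the assumed gap.\<close>
    then have "infdist x M \<le> dist x u + dist u w"
      using infdist_le[of w M x] dist_triangle[of x w u] by linarith
    then show False
      using assms(5) uN(2) v(2) w(2) dist_triangle[of x v q] by linarith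
  qed
  with w show ?thesis by auto
qed

definition spread_projection_sets :: "'a::metric_space set \<Rightarrow> 'a \<Rightarrow> real \<Rightarrow> 'a set set" where
  "spread_projection_sets C x \<epsilon> = {M \<in> compact_subsets C.
     \<exists>u\<in>metric_projection M x. \<exists>v\<in>metric_projection M x. \<epsilon> < dist u v}"

lemma porous_spread_projection_sets:
  fixes C :: "'a::real_normed_vector set"
  assumes "convex C" "x \<in> C" "0 < \<epsilon>"
  shows "porous (hyperspace C) (spread_projection_sets C x \<epsilon>)"
  unfolding porous_def
proof (intro conjI ballI)
  show "spread_projection_sets C x \<epsilon> \<subseteq> mspace (hyperspace C)"
    by (auto simp: spread_projection_sets_def)
next
  fix M assume "M \<in> spread_projection_sets C x \<epsilon>"
  then obtain p p' where MC: "M \<in> compact_subsets C"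
    and p: "p \<in> metric_projection M x" and p': "p' \<in> metric_projection M x" "\<epsilon> < dist p p'"
    by (auto simp: spread_projection_sets_def)
  have M: "compact M" "M \<noteq> {}" "M \<subseteq> C"
    using MC by (auto simp: compact_subsets_def)
  define d where "d = dist x p"
  have d: "d = infdist x M" "p \<in> M" "dist x p' = d"
    using p p' by (auto simp: metric_projection_def d_def)
  \<comment> \<open>Both \<open>p\<close> and \<open>p'\<close> lie at distance \<open>d\<close>
    from \<open>x\<close>, so \<epsilon> < \<open>2 * d\<close>.\<close>
  have "0 < d"
    using d(3) p'(2) assms(3) dist_triangle3[of p p' x] unfolding d_def by linarith
  show "porous_at (hyperspace C) (spread_projection_sets C x \<epsilon>) M"
    unfolding porous_at_def
  \<comment> \<open>Radii below \<open>d\<close> keep \<open>q\<close> strictly between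
    \<open>p\<close> and \<open>x\<close>; radii below \<epsilon> make \<open>r / 4\<close> smaller
    than \<epsilon> at the end.\<close>
  proof (rule exI[of _ "min d \<epsilon>"], intro conjI)
    show "0 < min d \<epsilon>" using \<open>0 < d\<close> assms(3) by simp
    show "\<exists>\<alpha>>0. \<forall>r. 0 < r \<and> r < min d \<epsilon> \<longrightarrow> (\<exists>M'\<in>mball_of (hyperspace C) M r.
        mball_of (hyperspace C) M' (\<alpha> * r) \<inter> spread_projection_sets C x \<epsilon> = {})"
    proof (rule exI[of _ "1/8"], intro conjI allI impI)
      fix r assume r: "0 < r \<and> r < min d \<epsilon>"
      \<comment> \<open>This \<open>t\<close> moves \<open>p\<close> by exactly \<open>r / 2\<close>
        towards \<open>x\<close>, so \<open>insert q M\<close> stays in the ball of radius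
        \<open>r\<close> and \<open>q\<close> is nearer to \<open>x\<close> than \<open>M\<close> by
        \<open>r / 2\<close>.\<close>
      define t where "t = r / 2 / d"
      define q where "q = (1 - t) *\<^sub>R p + t *\<^sub>R x"
      have t: "0 < t" "t < 1" "t * d = r / 2"
        using r \<open>0 < d\<close> by (auto simp: t_def field_simps)
      have "q \<in> C"
        unfolding q_def using assms(1,2) M(3) d(2) t by (intro convexD) auto
      have diff: "p - q = t *\<^sub>R (p - x)" "x - q = (1 - t) *\<^sub>R (x - p)"
        by (auto simp: q_def algebra_simps)
      have pq: "dist p q = r / 2"
        using t unfolding dist_norm diff d_def by (simp add: norm_minus_commute)
      have "dist x q = (1 - t) * d"
        using t unfolding dist_norm diff d_def by simp
      then have xq: "dist x q = d - r / 2"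
        using t(3) by (simp add: left_diff_distrib)
      have qM: "insert q M \<in> compact_subsets C"
        using M \<open>q \<in> C\<close> by (auto simp: compact_subsets_def)
      show "\<exists>M'\<in>mball_of (hyperspace C) M r.
          mball_of (hyperspace C) M' (1/8 * r) \<inter> spread_projection_sets C x \<epsilon> = {}"
      proof (rule bexI[of _ "insert q M"])
        show "insert q M \<in> mball_of (hyperspace C) M r"
          using hausdorff_distance_insert_le[OF d(2), of q] MC qM r pq
          by (simp add: mdist_hyperspace)
        show "mball_of (hyperspace C) (insert q M) (1/8 * r) \<inter> spread_projection_sets C x \<epsilon> = {}"
        proof (rule equals0I)
          fix N
          assume "N \<in> mball_of (hyperspace C) (insert q M) (1/8 * r) \<inter> spread_projection_sets C x \<epsilon>"
          then obtain u v where NC: "N \<in> compact_subsets C"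
            and H: "hausdorff_distance N (insert q M) < 1/8 * r"
            and uv: "u \<in> metric_projection N x" "v \<in> metric_projection N x" "\<epsilon> < dist u v"
            using qM by (auto simp: spread_projection_sets_def mdist_hyperspace
                hausdorff_distance_commute)
          \<comment> \<open>With \<open>e = r / 8\<close> the required gap
            \<open>2 * e = r / 4\<close> is covered by the available \<open>r / 2\<close>.\<close>
          have near: "dist w q < 1/8 * r" if "w \<in> metric_projection N x" for w
            using metric_projection_near_inserted_point[OF _ _ M(1) H _ that] NC d(1) xq r
            by (auto simp: compact_subsets_def)
          \<comment> \<open>Both points are within \<open>r / 8\<close> of \<open>q\<close>, hence
            less than \<open>r / 4\<close> < \<epsilon> apart.\<close>
          show False
            using near[OF uv(1)] near[OF uv(2)] uv(3) r dist_triangle2[of u v q] by auto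
        qed
      qed
    qed simp
  qed
qed

theorem theorem3p3:
  fixes C :: "'a::banach set" and x :: 'a
  assumes "closed C" and "bounded C" and "convex C" and "x \<in> C"
  shows "\<exists>\<B>. \<B> \<subseteq> compact_subsets C \<and>
    sigma_porous (hyperspace C) (compact_subsets C - \<B>) \<and>
    (\<forall>M\<in>\<B>. is_singleton (metric_projection M x))"
proof -
  define \<B> where "\<B> = {M \<in> compact_subsets C. is_singleton (metric_projection M x)}"
  define E where "E n = spread_projection_sets C x (inverse (real (Suc n)))" for n
  have "compact_subsets C - \<B> = \<Union> (range E)"
  proof (intro equalityI subsetI)
    fix M assume M: "M \<in> compact_subsets C - \<B>"
    then obtain u where u: "u \<in> metric_projection M x"
      using metric_projection_nonempty[of M x] by (auto simp: compact_subsets_def)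
    then obtain v where v: "v \<in> metric_projection M x" "u \<noteq> v"
      using M by (auto simp: \<B>_def is_singleton_def)
    then obtain n where "inverse (real (Suc n)) < dist u v"
      using reals_Archimedean[of "dist u v"] by auto
    then show "M \<in> \<Union> (range E)"
      using M u v by (auto simp: E_def spread_projection_sets_def)
  next
    \<comment> \<open>Since \<open>sigma_porous\<close> asks for equality with the union, this
      inclusion must be shown too.\<close>
    fix M assume "M \<in> \<Union> (range E)"
    then obtain n u v where "M \<in> compact_subsets C" and uv: "u \<in> metric_projection M x"
      "v \<in> metric_projection M x" "inverse (real (Suc n)) < dist u v"
      by (auto simp: E_def spread_projection_sets_def)
    moreover have "u \<noteq> v"
      using uv(3) by (auto simp: not_less)
    ultimately show "M \<in> compact_subsets C - \<B>"
      by (auto simp: \<B>_def is_singleton_def)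
  qed
  moreover have "porous (hyperspace C) (E n)" for n
    unfolding E_def using assms(3,4) by (intro porous_spread_projection_sets) auto
  ultimately have "sigma_porous (hyperspace C) (compact_subsets C - \<B>)"
    unfolding sigma_porous_def by (intro exI[of _ "range E"]) auto
  then show ?thesis
    by (intro exI[of _ \<B>]) (auto simp: \<B>_def)
qed

end
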